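(* Let $m,N\in\mathbb{N}$, let $\bm A\in\mathbb{R}^{m\times N}$ be a matrix, let $\bm u\in\mathbb{R}^{m\times\mathbb{N}}$ with $\|\bm u\|_{2,2}<\infty$, put $\bm H:=\bm A^*\bm A$, and let $0<\tau<2/\|\bm H\|_2$. Let $\bm x^0\in\mathcal{H}$ be arbitrary and let $\{\bm x^k\}_{k\ge 0}$ be generated by the forward-backward iterations $\bm x^{k+1}=J_\tau(G_\tau(\bm x^k))$, $k\ge 0$. Then $\{\bm x^k\}$ converges strongly (i.e. in the norm $\|\cdot\|_{2,2}$) to some $\bm x^*\in X^*$.
   Context: For a real matrix $\bm x$ with finitely many rows and infinitely many columns indexed by $\mathbb{N}$, $\bm x_j$ denotes its $j$-th row. $\|\cdot\|_2$ denotes the $\ell_2$ norm of a row (a sequence in $\mathbb{R}^{\mathbb{N}}$), and $\|\bm H\|_2$ is the spectral norm of the finite matrix $\bm H$. $\|\bm x\|_{2,q}=(\sum_i\|\bm x_i\|_2^q)^{1/q}$, the sum running over rows. $\mathcal{H}=\{\bm x\in\mathbb{R}^{N\times\mathbb{N}}:\|\bm x\|_{2,2}<\infty\}$, a Hilbert space with the inner product $\langle\cdot,\cdot\rangle_{2,2}$ inducing $\|\cdot\|_{2,2}$. The matrix $\bm A$ acts on $\bm x\in\mathcal{H}$ by the matrix product $\bm A\bm x\in\mathbb{R}^{m\times\mathbb{N}}$, and $\bm A^*$ is its transpose. On $\mathcal{H}$ define $\phi_1(\bm x)=\|\bm x\|_{2,1}$ and $\phi_2(\bm x)=\frac12\|\bm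 A\bm x-\bm u\|_{2,2}^2$, so $\nabla\phi_2(\bm x)=\bm A^*(\bm A\bm x-\bm u)$. The set $X^*:=\{\bm x\in\mathcal{H}:\bm 0\in\partial\phi_1(\bm x)+\{\nabla\phi_2(\bm x)\}\}$, where $\partial\phi_1$ is the convex subdifferential in $\mathcal{H}$, is the set of solutions of $\min_{\bm x\in\mathcal{H}}\phi_1(\bm x)+\phi_2(\bm x)$. The forward operator is $G_\tau(\bm x)=\bm x-\tau\nabla\phi_2(\bm x)=\bm x-\tau\bm A^*(\bm A\bm x-\bm u)$. The backward operator is $J_\tau=(I+\tau\,\partial\phi_1)^{-1}$, given row-wise for $1\le j\le N$ by $(J_\tau(\bm x))_j=\frac{\bm x_j}{\|\bm x_j\|_2}\max\{\|\bm x_j\|_2-\tau,0\}$ (understood as $\bm 0$ if $\bm x_j=\bm 0$). *)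

theory Defs
  imports "HOL-Analysis.Analysis"
begin

text \<open>
  A row of the infinite matrices is an element of the type \<open>ell2\<close> of square-summable real
  sequences. The space of real \<open>N \<times> \<nat>\<close> matrices with finite \<open>(2,2)\<close>-norm is the type
  \<open>ell2 ^ 'n\<close> with \<open>CARD('n) = N\<close>: such a matrix has finite \<open>(2,2)\<close>-norm iff each of its
  finitely many rows is square-summable. The library norm and inner product of
  \<open>ell2 ^ 'n\<close> are the \<open>(2,2)\<close>-norm (lemma \<open>mixed_norm_2\<close>) and
  \<open>\<Sum>j. inner (x $ j) (y $ j)\<close> (\<open>inner_vec_def\<close>).
\<close>

typedef ell2 = "{f :: nat \<Rightarrow> real. summable (\<lambda>i. (f i)\<^sup>2)}"
  morphisms entry Abs_ell2
proof
  show "(\<lambda>_. 0) \<in> {f :: nat \<Rightarrow> real. summable (\<lambda>i. (f i)\<^sup>2)}"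
    by simp
qed

setup_lifting type_definition_ell2

lemma summable_entry_sq: "summable (\<lambda>i. (entry r i)\<^sup>2)"
  using entry[of r] by simp

lemma summable_mult_of_squares:
  fixes f g :: "nat \<Rightarrow> real"
  assumes "summable (\<lambda>i. (f i)\<^sup>2)" "summable (\<lambda>i. (g i)\<^sup>2)"
  shows "summable (\<lambda>i. f i * g i)"
proof (rule summable_comparison_test'[OF summable_add[OF assms], of 0])
  fix i :: nat
  have "0 \<le> (\<bar>f i\<bar> - \<bar>g i\<bar>)\<^sup>2" by simp
  then have "2 * (\<bar>f i\<bar> * \<bar>g i\<bar>) \<le> (f i)\<^sup>2 + (g i)\<^sup>2"
    by (simp add: power2_diff)
  moreover have "0 \<le> \<bar>f i\<bar> * \<bar>g i\<bar>" by simp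
  ultimately show "norm (f i * g i) \<le> (f i)\<^sup>2 + (g i)\<^sup>2"
    unfolding real_norm_def abs_mult by linarith
qed

lemma summable_add_sq:
  fixes f g :: "nat \<Rightarrow> real"
  assumes "summable (\<lambda>i. (f i)\<^sup>2)" "summable (\<lambda>i. (g i)\<^sup>2)"
  shows "summable (\<lambda>i. (f i + g i)\<^sup>2)"
proof -
  have "summable (\<lambda>i. (f i)\<^sup>2 + (g i)\<^sup>2 + 2 * (f i * g i))"
    by (intro summable_add summable_mult assms summable_mult_of_squares)
  then show ?thesis by (simp add: power2_sum mult.assoc)
qed

lemma summable_entry_mult: "summable (\<lambda>i. entry r i * entry s i)"
  by (intro summable_mult_of_squares summable_entry_sq)

instantiation ell2 :: real_vector
begin

lift_definition zero_ell2 :: ell2 is "\<lambda>_. 0" by simp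

lift_definition plus_ell2 :: "ell2 \<Rightarrow> ell2 \<Rightarrow> ell2" is "\<lambda>f g i. f i + g i"
  by (rule summable_add_sq)

lift_definition uminus_ell2 :: "ell2 \<Rightarrow> ell2" is "\<lambda>f i. - f i" by simp

lift_definition minus_ell2 :: "ell2 \<Rightarrow> ell2 \<Rightarrow> ell2" is "\<lambda>f g i. f i - g i"
proof -
  fix f g :: "nat \<Rightarrow> real"
  assume "summable (\<lambda>i. (f i)\<^sup>2)" "summable (\<lambda>i. (g i)\<^sup>2)"
  then show "summable (\<lambda>i. (f i - g i)\<^sup>2)"
    using summable_add_sq[of f "\<lambda>i. - g i"] by simp
qed

lift_definition scaleR_ell2 :: "real \<Rightarrow> ell2 \<Rightarrow> ell2" is "\<lambda>c f i. c * f i"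
  by (simp add: power_mult_distrib summable_mult)

instance
  by standard (transfer; simp add: algebra_simps fun_eq_iff)+

end

instantiation ell2 :: real_inner
begin

definition inner_ell2 :: "ell2 \<Rightarrow> ell2 \<Rightarrow> real" where
  "inner_ell2 r s = (\<Sum>i. entry r i * entry s i)"

definition norm_ell2 :: "ell2 \<Rightarrow> real" where
  "norm_ell2 r = sqrt (\<Sum>i. (entry r i)\<^sup>2)"

definition sgn_ell2 :: "ell2 \<Rightarrow> ell2" where
  "sgn_ell2 r = r /\<^sub>R norm r"

definition dist_ell2 :: "ell2 \<Rightarrow> ell2 \<Rightarrow> real" where
  "dist_ell2 r s = norm (r - s)"

definition uniformity_ell2 :: "(ell2 \<times> ell2) filter" where
  "uniformity_ell2 = (INF e\<in>{0 <..}. principal {(r, s). dist r s < e})"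

definition open_ell2 :: "ell2 set \<Rightarrow> bool" where
  "open_ell2 S = (\<forall>r\<in>S. \<forall>\<^sub>F (r', s) in uniformity. r' = r \<longrightarrow> s \<in> S)"

instance
proof
  fix r s t :: ell2 and c :: real
  show "sgn r = r /\<^sub>R norm r" by (rule sgn_ell2_def)
  show "dist r s = norm (r - s)" by (rule dist_ell2_def)
  show "uniformity = (INF e\<in>{0 <..}. principal {(r :: ell2, s). dist r s < e})"
    by (rule uniformity_ell2_def)
  show "inner r s = inner s r" by (simp add: inner_ell2_def mult.commute)
  show "inner (r + s) t = inner r t + inner s t"
    by (simp add: inner_ell2_def plus_ell2.rep_eq distrib_right
        suminf_add[OF summable_entry_mult summable_entry_mult])
  show "inner (c *\<^sub>R r) s = c * inner r s"
    by (simp add: inner_ell2_def scaleR_ell2.rep_eq mult.assoc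
        suminf_mult[OF summable_entry_mult])
  show "0 \<le> inner r r"
    by (simp add: inner_ell2_def suminf_nonneg[OF summable_entry_mult])
  show "inner r r = 0 \<longleftrightarrow> r = 0"
  proof -
    have "inner r r = 0 \<longleftrightarrow> (\<forall>i. entry r i * entry r i = 0)"
      unfolding inner_ell2_def by (rule suminf_eq_zero_iff[OF summable_entry_mult]) simp
    also have "\<dots> \<longleftrightarrow> r = 0"
      by transfer (simp add: fun_eq_iff)
    finally show ?thesis .
  qed
  show "norm r = sqrt (inner r r)"
    by (simp add: norm_ell2_def inner_ell2_def power2_eq_square)
next
  show "open S = (\<forall>r\<in>S. \<forall>\<^sub>F (r', s) in uniformity. r' = r \<longrightarrow> s \<in> S)" for S :: "ell2 set"
    by (rule open_ell2_def)
qed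

end

definition mixed_norm :: "real \<Rightarrow> 'a::real_normed_vector ^ 'n \<Rightarrow> real" where
  "mixed_norm q x = (\<Sum>j\<in>UNIV. norm (x $ j) powr q) powr (1 / q)"

lemma mixed_norm_2: "mixed_norm 2 x = norm x"
  by (simp add: mixed_norm_def norm_vec_def L2_set_def powr_half_sqrt sum_nonneg)

lemma mixed_norm_1: "mixed_norm 1 x = (\<Sum>j\<in>UNIV. norm (x $ j))"
  by (simp add: mixed_norm_def sum_nonneg)

text \<open>
  The library product \<open>**\<close> needs both factors over one semiring, so the product of a finite
  real matrix with a column of rows is written out here.
\<close>

definition mat_act :: "real ^ 'n ^ 'm \<Rightarrow> 'a::real_vector ^ 'n \<Rightarrow> 'a ^ 'm"  (infixr \<open>\<odot>\<close> 75) where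
  "A \<odot> x = (\<chi> i. \<Sum>j\<in>UNIV. (A $ i $ j) *\<^sub>R (x $ j))"

lemma entry_mat_act:
  fixes x :: "ell2 ^ 'n"
  shows "entry ((A \<odot> x) $ i) k = (\<Sum>j\<in>UNIV. A $ i $ j * entry (x $ j) k)"
proof -
  have "entry (\<Sum>j\<in>S. (A $ i $ j) *\<^sub>R (x $ j)) k = (\<Sum>j\<in>S. A $ i $ j * entry (x $ j) k)"
    if "finite S" for S
    using that by induction (simp_all add: zero_ell2.rep_eq plus_ell2.rep_eq scaleR_ell2.rep_eq)
  then show ?thesis by (simp add: mat_act_def)
qed

definition spectral_norm :: "real ^ 'n ^ 'm \<Rightarrow> real" where
  "spectral_norm M = onorm (\<lambda>v. M *v v)"

text \<open>
  Quotients \<open>c / spectral_norm M\<close> with \<open>c > 0\<close> are formed in \<open>ereal\<close>, where they are \<open>\<infinity>\<close> for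
  \<open>M = 0\<close>; in \<open>real\<close> they would be \<open>0\<close>.
\<close>

lemma ereal_less_divide_spectral_norm_zero:
  "ereal t < 2 / ereal (spectral_norm (0 :: real ^ 'n ^ 'm))"
  by (simp add: spectral_norm_def onorm_zero divide_ereal_def)

definition subdifferential :: "('a::real_inner \<Rightarrow> real) \<Rightarrow> 'a \<Rightarrow> 'a set" where
  "subdifferential f x = {v. \<forall>y. f x + inner v (y - x) \<le> f y}"

definition gradient :: "('a::real_inner \<Rightarrow> real) \<Rightarrow> 'a \<Rightarrow> 'a" where
  "gradient f x = (THE g. GDERIV f x :> g)"

text \<open>\<open>(I + \<tau> \<partial>f)\<^sup>-\<^sup>1\<close> as a single-valued map.\<close>

definition resolvent :: "real \<Rightarrow> ('a::real_inner \<Rightarrow> real) \<Rightarrow> 'a \<Rightarrow> 'a" where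
  "resolvent \<tau> f x = (THE y. \<exists>v \<in> subdifferential f y. x = y + \<tau> *\<^sub>R v)"

definition phi1 :: "'a::real_inner ^ 'n \<Rightarrow> real" where
  "phi1 x = mixed_norm 1 x"

definition phi2 :: "real ^ 'n ^ 'm \<Rightarrow> 'a::real_inner ^ 'm \<Rightarrow> 'a ^ 'n \<Rightarrow> real" where
  "phi2 A u x = 1 / 2 * (mixed_norm 2 (A \<odot> x - u))\<^sup>2"

text \<open>The sum of the two sets is the Minkowski sum.\<close>

definition solution_set :: "real ^ 'n ^ 'm \<Rightarrow> 'a::real_inner ^ 'm \<Rightarrow> ('a ^ 'n) set" where
  "solution_set A u = {x. 0 \<in> subdifferential phi1 x + {gradient (phi2 A u) x}}"

definition forward_op :: "real ^ 'n ^ 'm \<Rightarrow> 'a::real_inner ^ 'm \<Rightarrow> real \<Rightarrow> 'a ^ 'n \<Rightarrow> 'a ^ 'n" where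
  "forward_op A u \<tau> x = x - \<tau> *\<^sub>R gradient (phi2 A u) x"

definition backward_op :: "real \<Rightarrow> 'a::real_inner ^ 'n \<Rightarrow> 'a ^ 'n" where
  "backward_op \<tau> = resolvent \<tau> phi1"


subsection \<open>Closed forms of the gradient and of the backward operator\<close>

lemma linear_mat_act: "linear ((\<odot>) A)"
  by (rule linearI)
    (simp_all add: mat_act_def vec_eq_iff scaleR_add_right sum.distrib scaleR_sum_right mult.commute)

lemma norm_mat_act_le:
  fixes x :: "'a::real_normed_vector ^ 'n" and A :: "real ^ 'n ^ 'm"
  shows "norm (A \<odot> x) \<le> norm x * (\<Sum>i\<in>UNIV. \<Sum>j\<in>UNIV. \<bar>A $ i $ j\<bar>)"
proof -
  have "norm (A \<odot> x) \<le> (\<Sum>i\<in>UNIV. norm ((A \<odot> x) $ i))"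
    unfolding norm_vec_def by (rule L2_set_le_sum) simp
  also have "\<dots> \<le> (\<Sum>i\<in>UNIV. \<Sum>j\<in>UNIV. \<bar>A $ i $ j\<bar> * norm x)"
  proof (rule sum_mono)
    fix i
    have "norm ((A \<odot> x) $ i) \<le> (\<Sum>j\<in>UNIV. norm ((A $ i $ j) *\<^sub>R (x $ j)))"
      unfolding mat_act_def by (simp only: vec_lambda_beta norm_sum)
    also have "\<dots> \<le> (\<Sum>j\<in>UNIV. \<bar>A $ i $ j\<bar> * norm x)"
      by (intro sum_mono) (simp add: mult_left_mono Finite_Cartesian_Product.norm_nth_le)
    finally show "norm ((A \<odot> x) $ i) \<le> (\<Sum>j\<in>UNIV. \<bar>A $ i $ j\<bar> * norm x)" .
  qed
  finally show ?thesis by (simp add: sum_distrib_left mult.commute)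
qed

lemma bounded_linear_mat_act:
  "bounded_linear ((\<odot>) A :: 'a::real_normed_vector ^ 'n \<Rightarrow> 'a ^ 'm)"
proof (rule bounded_linear_intro)
  show "norm (A \<odot> x) \<le> norm x * (\<Sum>i\<in>UNIV. \<Sum>j\<in>UNIV. \<bar>A $ i $ j\<bar>)" for x :: "'a ^ 'n"
    by (rule norm_mat_act_le)
qed (simp_all add: linear_add[OF linear_mat_act] linear_scale[OF linear_mat_act])

lemma inner_mat_act:
  fixes x :: "'a::real_inner ^ 'n"
  shows "inner (A \<odot> x) y = inner x (transpose A \<odot> y)"
proof -
  have "inner (A \<odot> x) y = (\<Sum>i\<in>UNIV. \<Sum>j\<in>UNIV. A $ i $ j * inner (x $ j) (y $ i))"
    by (simp add: inner_vec_def mat_act_def inner_sum_left)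
  also have "\<dots> = (\<Sum>j\<in>UNIV. \<Sum>i\<in>UNIV. A $ i $ j * inner (x $ j) (y $ i))"
    by (rule sum.swap)
  also have "\<dots> = inner x (transpose A \<odot> y)"
    by (simp add: inner_vec_def mat_act_def inner_sum_right transpose_def)
  finally show ?thesis .
qed

lemma GDERIV_phi2: "GDERIV (phi2 A u) x :> transpose A \<odot> (A \<odot> x - u)"
proof -
  have eq: "phi2 A u = (\<lambda>x. 1 / 2 * inner (A \<odot> x - u) (A \<odot> x - u))"
    by (simp add: phi2_def mixed_norm_2 power2_norm_eq_inner fun_eq_iff)
  have "((\<lambda>x. A \<odot> x - u) has_derivative (\<lambda>h. A \<odot> h)) (at x)"
    using bounded_linear_imp_has_derivative[OF bounded_linear_mat_act] 
    by (auto intro!: derivative_eq_intros)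
  from has_derivative_inner[OF this this]
  have "((\<lambda>x. inner (A \<odot> x - u) (A \<odot> x - u)) has_derivative
      (\<lambda>h. inner (A \<odot> x - u) (A \<odot> h) + inner (A \<odot> h) (A \<odot> x - u))) (at x)" .
  from has_derivative_mult_right[OF this, of "1 / 2"]
  show ?thesis
    by (simp add: eq gderiv_def inner_commute[of "A \<odot> x - u"] inner_mat_act)
qed

lemma gradient_eq:
  assumes "GDERIV f x :> g"
  shows "gradient f x = g"
  unfolding gradient_def
proof (rule the_equality)
  show "GDERIV f x :> g" by (rule assms)
next
  fix g' assume "GDERIV f x :> g'"
  with assms have "(\<lambda>h. inner h g') = (\<lambda>h. inner h g)"
    unfolding gderiv_def by (metis has_derivative_unique)
  then have "inner (g' - g) (g' - g) = 0"
    by (metis inner_diff_right right_minus_eq)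
  then show "g' = g" by simp
qed

lemma gradient_phi2: "gradient (phi2 A u) x = transpose A \<odot> (A \<odot> x - u)"
  by (rule gradient_eq[OF GDERIV_phi2])

lemma resolvent_eq:
  assumes \<tau>: "0 < \<tau>" and v: "v \<in> subdifferential f y" and x: "x = y + \<tau> *\<^sub>R v"
  shows "resolvent \<tau> f x = y"
  unfolding resolvent_def
proof (rule the_equality)
  show "\<exists>v\<in>subdifferential f y. x = y + \<tau> *\<^sub>R v" using v x by blast
next
  fix z assume "\<exists>w\<in>subdifferential f z. x = z + \<tau> *\<^sub>R w"
  then obtain w where w: "w \<in> subdifferential f z" and xz: "x = z + \<tau> *\<^sub>R w" by blast
  have "f y + inner v (z - y) \<le> f z" "f z + inner w (y - z) \<le> f y"
    using v w by (auto simp: subdifferential_def)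
  then have mono: "inner (v - w) (z - y) \<le> 0"
    by (simp add: inner_diff_left inner_diff_right)
  have zy: "z - y = \<tau> *\<^sub>R (v - w)"
    using x xz by (simp add: algebra_simps)
  have "inner (z - y) (z - y) = \<tau> * inner (v - w) (z - y)"
    by (subst (1) zy) simp
  also have "\<dots> \<le> 0" using mono \<tau> by (simp add: mult_nonneg_nonpos)
  finally have "inner (z - y) (z - y) = 0"
    using inner_ge_zero[of "z - y"] by (rule order_antisym)
  then show "z = y" by (simp only: inner_eq_zero_iff right_minus_eq)
qed

lemma backward_op_row:
  fixes x :: "'a::real_inner ^ 'n"
  assumes \<tau>: "0 < \<tau>"
  shows "backward_op \<tau> x $ j = (max (norm (x $ j) - \<tau>) 0 / norm (x $ j)) *\<^sub>R x $ j"
proof -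
  define y :: "'a ^ 'n" where
    "y = (\<chi> j. (max (norm (x $ j) - \<tau>) 0 / norm (x $ j)) *\<^sub>R x $ j)"
  define v where "v = (1 / \<tau>) *\<^sub>R (x - y)"
  have row: "norm (y $ j) + inner (v $ j) (b - y $ j) \<le> norm b" for j and b :: 'a
  proof (cases "norm (x $ j) \<le> \<tau>")
    case True
    then have y0: "y $ j = 0" by (simp add: y_def)
    have "norm (v $ j) \<le> 1" using True \<tau> by (simp add: v_def y0)
    then have "norm (v $ j) * norm b \<le> 1 * norm b" by (intro mult_right_mono) auto
    with norm_cauchy_schwarz[of "v $ j" b] show ?thesis by (simp add: y0)
  next
    case False
    let ?n = "norm (x $ j)"
    have n: "?n > 0" "?n > \<tau>" using False \<tau> by auto
    have yj: "y $ j = (1 - \<tau> / ?n) *\<^sub>R x $ j"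
      using n by (simp add: y_def diff_divide_distrib)
    have vj: "v $ j = (1 / ?n) *\<^sub>R x $ j"
      using \<tau> n by (simp add: v_def yj algebra_simps)
    have nv: "norm (v $ j) = 1" using n by (simp add: vj)
    have ny: "norm (y $ j) = ?n - \<tau>"
      using n \<tau> by (simp add: y_def)
    have "inner (v $ j) (y $ j) = ?n - \<tau>"
      using n by (simp add: vj yj dot_square_norm power2_eq_square field_simps)
    then show ?thesis
      using norm_cauchy_schwarz[of "v $ j" b] nv ny by (simp add: inner_diff_right)
  qed
  have "v \<in> subdifferential phi1 y"
    unfolding subdifferential_def phi1_def mixed_norm_1 inner_vec_def
    using row by (auto simp flip: sum.distrib intro!: sum_mono)
  moreover have "x = y + \<tau> *\<^sub>R v" using \<tau> by (simp add: v_def)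
  ultimately have "backward_op \<tau> x = y"
    unfolding backward_op_def by (rule resolvent_eq[OF \<tau>])
  then show ?thesis by (simp add: y_def)
qed

end

theory Submission
  imports Defs
begin

text \<open>
  The space \<open>ell2 ^ 'n\<close> is infinite-dimensional, but a single orbit of the iteration is not. The
  forward step replaces the rows of its argument by linear combinations of these rows and the rows
  of \<open>u\<close>, and the backward step only rescales each row. Hence all iterates have their rows in the
  span of the finitely many rows of \<open>x 0\<close> and \<open>u\<close> (\<open>forward_backward_rows_in_span\<close>), and strong
  convergence becomes a finite-dimensional matter.

  Write \<open>T\<close> for the composition of the two steps and \<open>L\<close> for the spectral norm of
  \<open>H = transpose A ** A\<close>. Two facts about \<open>T\<close> suffice. Both rest on \<open>norm (A \<odot> y)\<^sup>2 \<le> L * norm y\<^sup>2\<close>,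
  which is the matrix inequality summed over the columns.

  \<^item> A step from \<open>y\<close> lowers the objective \<open>phi1 + phi2 A u\<close> by at least
    \<open>(1 / \<tau> - L / 2) * norm (T y - y)\<^sup>2\<close> (\<open>forward_backward_descent\<close>), where the factor is positive
    because \<open>\<tau> * L < 2\<close>. As the objective is nonnegative, the squared steps are summable, so the
    steps tend to \<open>0\<close>; as the objective dominates the norm, the iterates are bounded and, by the
    remark on their span, lie in a compact set.

  \<^item> \<open>T\<close> is nonexpansive, as a composition of nonexpansive maps (\<open>forward_op_nonexpansive\<close>,
    \<open>backward_op_nonexpansive\<close>).

  By compactness a subsequence of the orbit converges. Since the steps tend to \<open>0\<close>, its limit is a
  fixed point of \<open>T\<close>, and since distances to a fixed point do not increase along the orbit, the
  whole sequence converges to it (\<open>nonexpansive_orbit_tendsto_fixed_point\<close>). The existence of a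
  minimizer is a by-product: fixed points of \<open>T\<close> solve the optimality condition
  (\<open>forward_backward_fixed_point_solution\<close>).
\<close>


section \<open>Orbits of nonexpansive maps\<close>

text \<open>
  A cluster point of the orbit is fixed by \<open>T\<close> because the steps vanish in the limit. The distance to
  a fixed point does not increase along the orbit, so it converges, and its limit can be read off from the
  subsequence that tends to the fixed point.
\<close>

lemma nonexpansive_orbit_tendsto_fixed_point:
  fixes T :: "'a::metric_space \<Rightarrow> 'a"
  assumes nonexp: "\<And>y z. dist (T y) (T z) \<le> dist y z"
    and step: "\<And>k. x (Suc k) = T (x k)"
    and K: "compact K" "range x \<subseteq> K"
    and regular: "(\<lambda>k. dist (x (Suc k)) (x k)) \<longlonglongrightarrow> 0"
  shows "\<exists>p. T p = p \<and> x \<longlonglongrightarrow> p"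
proof -
  obtain p r where r: "strict_mono r" and lim: "(x \<circ> r) \<longlonglongrightarrow> p"
    using K unfolding compact_def by (metis range_subsetD)
  have dist_p: "(\<lambda>k. dist (x (r k)) p) \<longlonglongrightarrow> 0"
    using lim tendsto_dist_iff[of "x \<circ> r" p sequentially] by (simp add: o_def)
  have regular_r: "(\<lambda>k. dist (x (Suc (r k))) (x (r k))) \<longlonglongrightarrow> 0"
    using LIMSEQ_subseq_LIMSEQ[OF regular r] by (simp add: o_def)
  have bound: "dist (T p) p
      \<le> dist (x (r k)) p + (dist (x (Suc (r k))) (x (r k)) + dist (x (r k)) p)" for k
  proof -
    have "dist (T p) (x (Suc (r k))) \<le> dist (x (r k)) p"
      using nonexp[of p "x (r k)"] by (simp add: step dist_commute)
    moreover have "dist (T p) p \<le> dist (T p) (x (Suc (r k))) + dist (x (Suc (r k))) p"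
      by (rule dist_triangle)
    moreover have "dist (x (Suc (r k))) p \<le> dist (x (Suc (r k))) (x (r k)) + dist (x (r k)) p"
      by (rule dist_triangle)
    ultimately show ?thesis by linarith
  qed
  have "(\<lambda>k. dist (x (r k)) p + (dist (x (Suc (r k))) (x (r k)) + dist (x (r k)) p)) \<longlonglongrightarrow> 0 + (0 + 0)"
    by (intro tendsto_add dist_p regular_r)
  then have "dist (T p) p \<le> 0 + (0 + 0)"
    by (rule tendsto_lowerbound) (intro always_eventually allI bound, simp)
  then have fixed: "T p = p" by simp
  have "decseq (\<lambda>k. dist (x k) p)"
    by (rule decseq_SucI) (metis fixed nonexp step)
  then have "convergent (\<lambda>k. dist (x k) p)"
    by (intro Bseq_monoseq_convergent decseq_imp_monoseq decseq_bounded[where B = 0]) auto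
  then obtain l where l: "(\<lambda>k. dist (x k) p) \<longlonglongrightarrow> l" by (auto simp: convergent_def)
  have "(\<lambda>k. dist (x (r k)) p) \<longlonglongrightarrow> l"
    using LIMSEQ_subseq_LIMSEQ[OF l r] by (simp add: o_def)
  with dist_p have "l = 0" by (rule LIMSEQ_unique[symmetric])
  with l have "x \<longlonglongrightarrow> p" using tendsto_dist_iff by blast
  with fixed show ?thesis by blast
qed


section \<open>Bounded sets in finite-dimensional subspaces\<close>

lemma compact_bounded_combinations:
  fixes C :: "'a::real_normed_vector set" and M :: "'a \<Rightarrow> real"
  assumes "finite C"
  shows "compact {\<Sum>c\<in>C. a c *\<^sub>R c | a. \<forall>c\<in>C. \<bar>a c\<bar> \<le> M c}"
  using assms
proof induction
  case empty
  then show ?case by simp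
next
  case (insert c C)
  let ?I = "(\<lambda>s. s *\<^sub>R c) ` {- M c..M c}"
  let ?K = "{\<Sum>c\<in>C. a c *\<^sub>R c | a. \<forall>c\<in>C. \<bar>a c\<bar> \<le> M c}"
  have "compact {y + z | y z. y \<in> ?I \<and> z \<in> ?K}"
    by (intro compact_sums insert.IH compact_continuous_image continuous_intros) auto
  moreover have "{\<Sum>c\<in>insert c C. a c *\<^sub>R c | a. \<forall>c\<in>insert c C. \<bar>a c\<bar> \<le> M c}
      = {y + z | y z. y \<in> ?I \<and> z \<in> ?K}" (is "?L = ?R")
  proof
    show "?L \<subseteq> ?R" using insert.hyps by (fastforce simp: abs_le_iff)
    show "?R \<subseteq> ?L"
    proof
      fix w assume "w \<in> ?R"
      then obtain s a where w: "w = s *\<^sub>R c + (\<Sum>c\<in>C. a c *\<^sub>R c)"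
        and sa: "s \<in> {- M c..M c}" "\<forall>c\<in>C. \<bar>a c\<bar> \<le> M c" by blast
      have "(\<Sum>b\<in>insert c C. (a(c := s)) b *\<^sub>R b) = w"
        using insert.hyps by (auto simp: w intro!: sum.cong)
      moreover have "\<forall>b\<in>insert c C. \<bar>(a(c := s)) b\<bar> \<le> M b"
        using sa by auto
      ultimately show "w \<in> ?L" by blast
    qed
  qed
  ultimately show ?case by simp
qed

text \<open>
  The ambient space is neither finite-dimensional nor assumed complete, so the Heine-Borel property
  is recovered through coordinates. Coordinates with respect to an orthogonal generating set are
  bounded by the norm of the vector, which puts the set inside the box of bounded combinations.
\<close>

lemma bounded_subset_span_imp_subset_compact:
  fixes B :: "'a::real_inner set"
  assumes "finite B" "S \<subseteq> span B" "bounded S"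
  shows "\<exists>K. compact K \<and> S \<subseteq> K"
proof -
  obtain C where C: "finite C" "span C = span B" "pairwise orthogonal C"
    using basis_orthogonal[OF \<open>finite B\<close>] by blast
  obtain r where r: "\<And>y. y \<in> S \<Longrightarrow> norm y \<le> r"
    using \<open>bounded S\<close> by (auto simp: bounded_iff)
  let ?K = "{\<Sum>c\<in>C. a c *\<^sub>R c | a. \<forall>c\<in>C. \<bar>a c\<bar> \<le> r / norm c}"
  have "S \<subseteq> ?K"
  proof
    fix y assume y: "y \<in> S"
    then obtain b where b: "y = (\<Sum>c\<in>C. b c *\<^sub>R c)"
      using assms C(1,2) span_finite[OF C(1)] by blast
    \<comment> \<open>The coefficient of a zero generator is arbitrary, while its bound \<open>r / norm 0\<close> is \<open>0\<close>.\<close>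
    let ?a = "\<lambda>c. if c = 0 then 0 else b c"
    have "\<bar>?a c\<bar> \<le> r / norm c" if c: "c \<in> C" for c
    proof (cases "c = 0")
      case False
      have "inner y c = (\<Sum>d\<in>C. b d * inner d c)"
        by (simp add: b inner_sum_left)
      also have "\<dots> = (\<Sum>d\<in>C. if d = c then b c * inner c c else 0)"
        using C(3) c by (intro sum.cong) (auto simp: pairwise_def orthogonal_def)
      also have "\<dots> = b c * (norm c)\<^sup>2"
        using C(1) c by (simp add: power2_norm_eq_inner)
      finally have "\<bar>b c\<bar> * (norm c)\<^sup>2 \<le> norm y * norm c"
        using Cauchy_Schwarz_ineq2[of y c] by (simp add: abs_mult)
      also have "\<dots> \<le> r * norm c" using r[OF y] by (simp add: mult_right_mono)
      finally show ?thesis using False by (simp add: field_simps power2_eq_square)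
    qed simp
    then have "\<forall>c\<in>C. \<bar>?a c\<bar> \<le> r / norm c" ..
    moreover have "y = (\<Sum>c\<in>C. ?a c *\<^sub>R c)" unfolding b by (rule sum.cong) auto
    ultimately show "y \<in> ?K" by (intro CollectI exI[of _ ?a] conjI)
  qed
  with compact_bounded_combinations[OF C(1)] show ?thesis by (rule exI[of _ ?K, OF conjI])
qed

lemma rows_in_span_imp_in_span_axis:
  fixes y :: "'a::real_vector ^ 'n"
  assumes "\<And>j. y $ j \<in> span R"
  shows "y \<in> span (\<Union>j. axis j ` R)"
proof -
  have lin: "linear (axis j :: 'a \<Rightarrow> 'a ^ 'n)" for j
    by (rule linearI) (simp_all add: vec_eq_iff axis_def)
  have "axis j (y $ j) \<in> span (\<Union>j. axis j ` R)" for j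
  proof -
    have "axis j (y $ j) \<in> span (axis j ` R)"
      using assms linear_span_image[OF lin] by blast
    then show ?thesis by (rule set_mp[OF span_mono, rotated]) blast
  qed
  then have "(\<Sum>j\<in>UNIV. axis j (y $ j)) \<in> span (\<Union>j. axis j ` R)"
    by (rule span_sum)
  moreover have "(\<Sum>j\<in>UNIV. axis j (y $ j)) = y"
    by (simp add: vec_eq_iff axis_def)
  ultimately show ?thesis by simp
qed


section \<open>The spectral norm bounds the action on infinite matrices\<close>

lemma power2_norm_matrix_vector_le:
  fixes A :: "real ^ 'n ^ 'm" and v :: "real ^ 'n"
  shows "(norm (A *v v))\<^sup>2 \<le> spectral_norm (transpose A ** A) * (norm v)\<^sup>2"
proof -
  have "(norm (A *v v))\<^sup>2 = inner v ((transpose A ** A) *v v)"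
    using dot_lmul_matrix[of "A *v v" A v]
    by (simp add: power2_norm_eq_inner matrix_vector_mul_assoc[symmetric] inner_commute)
  also have "\<dots> \<le> norm v * norm ((transpose A ** A) *v v)"
    by (rule norm_cauchy_schwarz)
  also have "\<dots> \<le> norm v * (spectral_norm (transpose A ** A) * norm v)"
    unfolding spectral_norm_def
    by (intro mult_left_mono onorm matrix_vector_mul_bounded_linear) auto
  finally show ?thesis by (simp add: power2_eq_square mult_ac)
qed

lemma sums_power2_norm_columns:
  fixes y :: "ell2 ^ 'n"
  shows "(\<lambda>k. (norm (\<chi> j. entry (y $ j) k))\<^sup>2) sums (norm y)\<^sup>2"
proof -
  have "(\<lambda>k. (entry r k)\<^sup>2) sums (norm r)\<^sup>2" for r
    using summable_sums[OF summable_entry_sq[of r]]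
    by (simp add: norm_ell2_def suminf_nonneg summable_entry_sq)
  then have "(\<lambda>k. \<Sum>j\<in>UNIV. (entry (y $ j) k)\<^sup>2) sums (\<Sum>j\<in>UNIV. (norm (y $ j))\<^sup>2)"
    by (intro sums_sum)
  then show ?thesis
    by (simp add: norm_vec_def L2_set_def sum_nonneg)
qed

text \<open>
  \<open>A\<close> acts on each of the infinitely many columns separately, and the squared norm is the sum of the
  squared norms of the columns, so the inequality for finite vectors can be summed.
\<close>

lemma power2_norm_mat_act_le:
  fixes A :: "real ^ 'n ^ 'm" and y :: "ell2 ^ 'n"
  shows "(norm (A \<odot> y))\<^sup>2 \<le> spectral_norm (transpose A ** A) * (norm y)\<^sup>2"
proof (rule sums_le)
  show "(\<lambda>k. (norm (\<chi> i. entry ((A \<odot> y) $ i) k))\<^sup>2) sums (norm (A \<odot> y))\<^sup>2"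
    by (rule sums_power2_norm_columns)
  show "(\<lambda>k. spectral_norm (transpose A ** A) * (norm (\<chi> j. entry (y $ j) k))\<^sup>2)
      sums (spectral_norm (transpose A ** A) * (norm y)\<^sup>2)"
    by (intro sums_mult sums_power2_norm_columns)
  fix k
  have "(\<chi> i. entry ((A \<odot> y) $ i) k) = A *v (\<chi> j. entry (y $ j) k)"
    by (simp add: vec_eq_iff entry_mat_act matrix_vector_mult_def)
  then show "(norm (\<chi> i. entry ((A \<odot> y) $ i) k))\<^sup>2
      \<le> spectral_norm (transpose A ** A) * (norm (\<chi> j. entry (y $ j) k))\<^sup>2"
    by (simp add: power2_norm_matrix_vector_le)
qed

lemma spectral_norm_nonneg: "0 \<le> spectral_norm M"
  unfolding spectral_norm_def by (rule onorm_pos_le) (rule matrix_vector_mul_bounded_linear)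

text \<open>
  An operator and its adjoint have the same norm: with \<open>w\<close> the image of \<open>z\<close> under the adjoint,
  \<open>norm w\<^sup>2\<close> is the inner product of \<open>A \<odot> w\<close> with \<open>z\<close>, to which Cauchy-Schwarz and the bound for \<open>A\<close>
  apply.
\<close>

lemma power2_norm_transpose_mat_act_le:
  fixes A :: "real ^ 'n ^ 'm" and z :: "ell2 ^ 'm"
  shows "(norm (transpose A \<odot> z))\<^sup>2 \<le> spectral_norm (transpose A ** A) * (norm z)\<^sup>2"
proof -
  let ?w = "transpose A \<odot> z" and ?L = "spectral_norm (transpose A ** A)"
  have "((norm ?w)\<^sup>2)\<^sup>2 = (inner (A \<odot> ?w) z)\<^sup>2"
    by (simp add: inner_mat_act power2_norm_eq_inner)
  also have "\<dots> \<le> (norm (A \<odot> ?w))\<^sup>2 * (norm z)\<^sup>2"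
    using Cauchy_Schwarz_ineq[of "A \<odot> ?w" z] by (simp add: power2_norm_eq_inner)
  also have "\<dots> \<le> ?L * (norm ?w)\<^sup>2 * (norm z)\<^sup>2"
    by (intro mult_right_mono power2_norm_mat_act_le) simp
  finally have le: "(norm ?w)\<^sup>2 * (norm ?w)\<^sup>2 \<le> (norm ?w)\<^sup>2 * (?L * (norm z)\<^sup>2)"
    by (simp add: power2_eq_square mult_ac)
  show ?thesis
  proof (cases "?w = 0")
    case False
    then show ?thesis by (intro mult_left_le_imp_le[OF le]) simp
  qed (simp add: spectral_norm_nonneg)
qed


section \<open>The forward and the backward step\<close>

text \<open>
  This is the inclusion that defines the resolvent. The resolvent is given by a definite description
  and carries information only once the inclusion is known to have a solution. Here that is read off
  from the row formula: per row, the difference \<open>x $ j - y $ j\<close> has norm at most \<open>\<tau>\<close>, and it is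
  aligned with \<open>y $ j\<close> and of norm exactly \<open>\<tau>\<close> unless \<open>y $ j = 0\<close>.
\<close>

lemma backward_op_subgradient:
  fixes x :: "'a::real_inner ^ 'n"
  assumes \<tau>: "0 < \<tau>"
  shows "(1 / \<tau>) *\<^sub>R (x - backward_op \<tau> x) \<in> subdifferential phi1 (backward_op \<tau> x)"
proof -
  define y where "y = backward_op \<tau> x"
  have row: "\<tau> * norm (y $ j) + inner (x $ j - y $ j) (z - y $ j) \<le> \<tau> * norm z" for j z
  proof -
    have yj: "y $ j = (max (norm (x $ j) - \<tau>) 0 / norm (x $ j)) *\<^sub>R x $ j"
      unfolding y_def by (rule backward_op_row[OF \<tau>])
    have "norm (x $ j - y $ j) \<le> \<tau> \<and> inner (x $ j - y $ j) (y $ j) = \<tau> * norm (y $ j)"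
    proof (cases "norm (x $ j) \<le> \<tau>")
      case True
      then show ?thesis by (simp add: yj)
    next
      case False
      let ?n = "norm (x $ j)"
      have n: "?n > 0" "?n > \<tau>" using False \<tau> by auto
      have y: "y $ j = ((?n - \<tau>) / ?n) *\<^sub>R x $ j" using n by (simp add: yj)
      have xy: "x $ j - y $ j = (\<tau> / ?n) *\<^sub>R x $ j"
        using n by (simp add: y diff_divide_distrib algebra_simps)
      have "inner (x $ j - y $ j) (y $ j) = \<tau> * (?n - \<tau>)"
        unfolding xy unfolding y using n by (simp add: dot_square_norm power2_eq_square)
      moreover have "norm (x $ j - y $ j) = \<tau>" unfolding xy using n \<tau> by simp
      moreover have "norm (y $ j) = ?n - \<tau>" unfolding y using n by simp
      ultimately show ?thesis by simp
    qed
    moreover have "inner (x $ j - y $ j) z \<le> norm (x $ j - y $ j) * norm z"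
      by (rule norm_cauchy_schwarz)
    moreover have "norm (x $ j - y $ j) * norm z \<le> \<tau> * norm z"
      using calculation(1) by (simp add: mult_right_mono)
    ultimately show ?thesis by (simp add: inner_diff_right)
  qed
  have "phi1 y + inner ((1 / \<tau>) *\<^sub>R (x - y)) (z - y) \<le> phi1 z" for z
  proof -
    have "\<tau> * phi1 y + inner (x - y) (z - y) \<le> \<tau> * phi1 z"
      unfolding phi1_def mixed_norm_1 inner_vec_def sum_distrib_left
      using row by (auto simp flip: sum.distrib intro!: sum_mono)
    moreover have "phi1 y + inner ((1 / \<tau>) *\<^sub>R (x - y)) (z - y)
        = (\<tau> * phi1 y + inner (x - y) (z - y)) / \<tau>"
      using \<tau> by (simp only: inner_scaleR_left) (simp add: add_divide_distrib)
    ultimately show ?thesis using \<tau> by (simp add: pos_divide_le_eq mult.commute)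
  qed
  then show ?thesis unfolding subdifferential_def y_def by blast
qed

text \<open>
  Adding the subgradient inequalities at the two images shows that the resolvent is even firmly
  nonexpansive: the squared distance of the images is at most the inner product of \<open>y - z\<close> with
  their difference.
\<close>

lemma backward_op_nonexpansive:
  fixes y z :: "'a::real_inner ^ 'n"
  assumes \<tau>: "0 < \<tau>"
  shows "norm (backward_op \<tau> y - backward_op \<tau> z) \<le> norm (y - z)"
proof -
  let ?p = "backward_op \<tau> y" and ?q = "backward_op \<tau> z"
  have "phi1 ?p + inner (y - ?p) (?q - ?p) / \<tau> \<le> phi1 ?q"
    "phi1 ?q + inner (z - ?q) (?p - ?q) / \<tau> \<le> phi1 ?p"
    using backward_op_subgradient[OF \<tau>, of y] backward_op_subgradient[OF \<tau>, of z]
    by (auto simp: subdifferential_def)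
  then have "(inner (y - ?p) (?q - ?p) + inner (z - ?q) (?p - ?q)) / \<tau> \<le> 0"
    by (simp add: add_divide_distrib)
  then have "inner (y - ?p) (?q - ?p) + inner (z - ?q) (?p - ?q) \<le> 0"
    using \<tau> by (simp add: divide_le_0_iff)
  then have "norm (?p - ?q) * norm (?p - ?q) \<le> inner (y - z) (?p - ?q)"
    by (simp add: power2_eq_square[symmetric] power2_norm_eq_inner inner_diff_left
        inner_diff_right inner_commute)
  also have "\<dots> \<le> norm (y - z) * norm (?p - ?q)" by (rule norm_cauchy_schwarz)
  finally show ?thesis
    by (cases "norm (?p - ?q) = 0") simp_all
qed

text \<open>
  For \<open>d = y - z\<close> the squared norm of \<open>d - \<tau> H d\<close> is
  \<open>norm d\<^sup>2 - 2 * \<tau> * norm (A \<odot> d)\<^sup>2 + \<tau>\<^sup>2 * norm (H d)\<^sup>2\<close>. The bound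
  \<open>norm (H d)\<^sup>2 \<le> L * norm (A \<odot> d)\<^sup>2\<close> makes the last two terms together at most
  \<open>\<tau> * (\<tau> * L - 2) * norm (A \<odot> d)\<^sup>2 \<le> 0\<close>.
\<close>

lemma forward_op_nonexpansive:
  fixes A :: "real ^ 'n ^ 'm" and u :: "ell2 ^ 'm"
  assumes \<tau>: "0 < \<tau>" "\<tau> * spectral_norm (transpose A ** A) \<le> 2"
  shows "norm (forward_op A u \<tau> y - forward_op A u \<tau> z) \<le> norm (y - z)"
proof -
  let ?L = "spectral_norm (transpose A ** A)"
  define d where "d = y - z"
  define w where "w = transpose A \<odot> (A \<odot> d)"
  have diff: "forward_op A u \<tau> y - forward_op A u \<tau> z = d - \<tau> *\<^sub>R w"
    by (simp add: forward_op_def gradient_phi2 d_def w_def linear_diff[OF linear_mat_act]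
        algebra_simps)
  have "inner d w = (norm (A \<odot> d))\<^sup>2"
    by (simp add: w_def power2_norm_eq_inner inner_mat_act)
  moreover have "(norm (d - \<tau> *\<^sub>R w))\<^sup>2 = (norm d)\<^sup>2 - 2 * \<tau> * inner d w + \<tau>\<^sup>2 * (norm w)\<^sup>2"
    unfolding power2_norm_eq_inner
    by (simp add: inner_diff_left inner_diff_right inner_commute power2_eq_square)
  moreover have "\<tau>\<^sup>2 * (norm w)\<^sup>2 \<le> \<tau>\<^sup>2 * (?L * (norm (A \<odot> d))\<^sup>2)"
    unfolding w_def by (intro mult_left_mono power2_norm_transpose_mat_act_le) simp
  moreover have "\<tau> * ((\<tau> * ?L) * (norm (A \<odot> d))\<^sup>2) \<le> \<tau> * (2 * (norm (A \<odot> d))\<^sup>2)"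
    using \<tau> by (intro mult_left_mono mult_right_mono) auto
  ultimately have "(norm (d - \<tau> *\<^sub>R w))\<^sup>2 \<le> (norm d)\<^sup>2"
    by (simp add: power2_eq_square mult_ac)
  then show ?thesis
    unfolding diff d_def[symmetric] by (rule power2_le_imp_le) simp
qed

text \<open>
  With \<open>d = T y - y\<close> and \<open>g\<close> the gradient at \<open>y\<close>, the subgradient inequality at \<open>T y\<close> gives a
  decrease of \<open>phi1\<close> by at least \<open>norm d\<^sup>2 / \<tau> + inner g d\<close>. The quadratic \<open>phi2\<close> grows by exactly
  \<open>inner g d + norm (A \<odot> d)\<^sup>2 / 2\<close>. The linear terms cancel, and
  \<open>norm (A \<odot> d)\<^sup>2\<close> is bounded through the spectral norm.
\<close>

lemma forward_backward_descent:
  fixes A :: "real ^ 'n ^ 'm" and u :: "ell2 ^ 'm"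
  assumes \<tau>: "0 < \<tau>"
  defines "T \<equiv> \<lambda>y. backward_op \<tau> (forward_op A u \<tau> y)"
  shows "phi1 (T y) + phi2 A u (T y)
      + (1 / \<tau> - spectral_norm (transpose A ** A) / 2) * (norm (T y - y))\<^sup>2
    \<le> phi1 y + phi2 A u y"
proof -
  define g where "g = transpose A \<odot> (A \<odot> y - u)"
  define d where "d = T y - y"
  have "phi1 (T y) + inner ((1 / \<tau>) *\<^sub>R (forward_op A u \<tau> y - T y)) (y - T y) \<le> phi1 y"
    using backward_op_subgradient[OF \<tau>, of "forward_op A u \<tau> y"]
    by (simp only: subdifferential_def T_def mem_Collect_eq)
  moreover have "(1 / \<tau>) *\<^sub>R (forward_op A u \<tau> y - T y) = - (1 / \<tau>) *\<^sub>R d - g"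
    using \<tau> by (simp add: forward_op_def gradient_phi2 d_def g_def algebra_simps)
  moreover have "y - T y = - d" by (simp add: d_def)
  ultimately have phi1: "phi1 (T y) + (norm d)\<^sup>2 / \<tau> + inner g d \<le> phi1 y"
    by (simp add: inner_diff_left power2_norm_eq_inner)
  define r where "r = A \<odot> y - u"
  have "A \<odot> T y - u = r + A \<odot> d"
    by (simp add: r_def d_def linear_diff[OF linear_mat_act])
  then have "phi2 A u (T y) = (norm (r + A \<odot> d))\<^sup>2 / 2" and "phi2 A u y = (norm r)\<^sup>2 / 2"
    unfolding phi2_def mixed_norm_2 r_def[symmetric] by simp_all
  then have "phi2 A u (T y) = phi2 A u y + inner (A \<odot> d) r + (norm (A \<odot> d))\<^sup>2 / 2"
    by (simp add: power2_norm_eq_inner inner_add_left inner_add_right inner_commute)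
  moreover have "inner (A \<odot> d) r = inner g d"
    by (simp add: g_def r_def inner_mat_act inner_commute)
  ultimately show ?thesis
    using phi1 power2_norm_mat_act_le[of A d]
    unfolding d_def[symmetric] by (simp add: left_diff_distrib)
qed

lemma forward_backward_rows_in_span:
  fixes A :: "real ^ 'n ^ 'm" and u :: "'a::real_inner ^ 'm"
  assumes "0 < \<tau>" and u: "\<And>i. u $ i \<in> span R" and y: "\<And>j. y $ j \<in> span R"
  shows "backward_op \<tau> (forward_op A u \<tau> y) $ j \<in> span R"
proof -
  have "forward_op A u \<tau> y $ j \<in> span R"
    unfolding forward_op_def gradient_phi2
    by (simp add: mat_act_def span_diff span_scale span_sum u y)
  then show ?thesis by (simp add: backward_op_row[OF \<open>0 < \<tau>\<close>] span_scale)
qed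

text \<open>
  At a fixed point the subgradient selected by the backward step is minus the gradient of \<open>phi2\<close>.
\<close>

lemma forward_backward_fixed_point_solution:
  fixes A :: "real ^ 'n ^ 'm" and u :: "'a::real_inner ^ 'm"
  assumes \<tau>: "0 < \<tau>" and p: "backward_op \<tau> (forward_op A u \<tau> p) = p"
  shows "p \<in> solution_set A u"
proof -
  let ?g = "gradient (phi2 A u) p"
  have "(1 / \<tau>) *\<^sub>R (forward_op A u \<tau> p - p) = - ?g"
    using \<tau> by (simp add: forward_op_def)
  then have "- ?g \<in> subdifferential phi1 p"
    using backward_op_subgradient[OF \<tau>, of "forward_op A u \<tau> p"] p by simp
  then have "- ?g + ?g \<in> subdifferential phi1 p + {?g}"
    by (intro set_plus_intro) auto
  then show ?thesis by (simp add: solution_set_def)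
qed


section \<open>Strong convergence\<close>

lemma summable_descent:
  fixes f e :: "nat \<Rightarrow> real"
  assumes "\<And>k. f (Suc k) + e k \<le> f k" "\<And>k. 0 \<le> f k" "\<And>k. 0 \<le> e k"
  shows "summable e"
proof (rule summableI_nonneg_bounded)
  have "f n + sum e {..<n} \<le> f 0" for n
  proof (induction n)
    case (Suc n)
    then show ?case using assms(1)[of n] by simp
  qed simp
  then show "sum e {..<n} \<le> f 0" for n
    using assms(2)[of n] by (meson add_increasing order_trans order_refl)
qed (rule assms)

theorem theorem3p7:
  fixes A :: "real ^ 'n ^ 'm"
    and u :: "ell2 ^ 'm"
    and H :: "real ^ 'n ^ 'n"
    and \<tau> :: real
    and x :: "nat \<Rightarrow> ell2 ^ 'n"
  assumes "H = transpose A ** A"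
    and "0 < \<tau>" and "ereal \<tau> < 2 / ereal (spectral_norm H)"
    and "\<And>k. x (Suc k) = backward_op \<tau> (forward_op A u \<tau> (x k))"
  shows "\<exists>xs \<in> solution_set A u. x \<longlonglongrightarrow> xs"
proof -
  note step = assms(4)
  let ?L = "spectral_norm (transpose A ** A)"
  let ?T = "\<lambda>y. backward_op \<tau> (forward_op A u \<tau> y)"
  define f where "f k = phi1 (x k) + phi2 A u (x k)" for k
  define c where "c = 1 / \<tau> - ?L / 2"
  have \<tau>: "0 < \<tau>" by fact
  \<comment> \<open>If \<open>H = 0\<close>, the bound on \<open>\<tau>\<close> is infinite; this case is trivial here.\<close>
  have \<tau>L: "\<tau> * ?L < 2"
  proof (cases "?L = 0")
    case False
    then have L: "0 < ?L" using spectral_norm_nonneg[of "transpose A ** A"] by linarith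
    have "ereal \<tau> < ereal (2 / ?L)" using assms(1,3) False by simp
    then show ?thesis using L by (simp add: field_simps)
  qed simp
  then have c: "0 < c" using \<tau> by (simp add: c_def field_simps)

  have descent: "f (Suc k) + c * (norm (x (Suc k) - x k))\<^sup>2 \<le> f k" for k
    using forward_backward_descent[OF \<tau>, of A u "x k"] by (simp add: f_def c_def step)
  have norm_le_f: "norm (x k) \<le> f k" for k
  proof -
    have "norm (x k) \<le> phi1 (x k)"
      unfolding phi1_def mixed_norm_1 norm_vec_def by (rule L2_set_le_sum) simp
    moreover have "0 \<le> phi2 A u (x k)" by (simp add: phi2_def)
    ultimately show ?thesis by (simp add: f_def)
  qed
  then have f_nonneg: "0 \<le> f k" for k using norm_ge_zero order_trans by blast

  have "summable (\<lambda>k. c * (norm (x (Suc k) - x k))\<^sup>2)"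
    using descent f_nonneg c by (intro summable_descent[of f]) auto
  then have "(\<lambda>k. (norm (x (Suc k) - x k))\<^sup>2) \<longlonglongrightarrow> 0"
    using c by (intro summable_LIMSEQ_zero) (simp add: summable_cmult_iff)
  then have "(\<lambda>k. sqrt ((norm (x (Suc k) - x k))\<^sup>2)) \<longlonglongrightarrow> sqrt 0"
    by (rule tendsto_real_sqrt)
  then have regular: "(\<lambda>k. dist (x (Suc k)) (x k)) \<longlonglongrightarrow> 0"
    by (simp add: dist_norm)

  have "decseq f"
  proof (rule decseq_SucI)
    fix k
    have "0 \<le> c * (norm (x (Suc k) - x k))\<^sup>2" using c by simp
    with descent[of k] show "f (Suc k) \<le> f k" by linarith
  qed
  then have "norm (x k) \<le> f 0" for k
    using norm_le_f[of k] decseqD[of f 0 k] by simp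
  then have bdd: "bounded (range x)" by (auto simp: bounded_iff)

  let ?R = "range (($) (x 0)) \<union> range (($) u)"
  have "x k $ j \<in> span ?R" for k j
  proof (induction k arbitrary: j)
    case 0
    then show ?case by (auto intro: span_base)
  next
    case (Suc k)
    then show ?case unfolding step
      by (intro forward_backward_rows_in_span \<tau>) (auto intro: span_base)
  qed
  then have "range x \<subseteq> span (\<Union>j. axis j ` ?R)"
    using rows_in_span_imp_in_span_axis by blast
  moreover have "finite (\<Union>j. axis j ` ?R)" by simp
  ultimately obtain K where K: "compact K" "range x \<subseteq> K"
    using bounded_subset_span_imp_subset_compact[OF _ _ bdd] by blast

  have "dist (?T y) (?T z) \<le> dist y z" for y z
    unfolding dist_norm
    using backward_op_nonexpansive[OF \<tau>] forward_op_nonexpansive[OF \<tau> less_imp_le[OF \<tau>L]]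
    by (rule order_trans)
  from nonexpansive_orbit_tendsto_fixed_point[of ?T x, OF this step K regular]
  obtain p where "?T p = p" "x \<longlonglongrightarrow> p" by blast
  then show ?thesis using forward_backward_fixed_point_solution[OF \<tau>] by blast
qed

end
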